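(* Let $\mathcal{S}$ be a strongly regular configuration with parameters $(v_k;\lambda,\mu)$, i.e. a symmetric $(v_k)$ configuration whose point graph is a strongly regular graph $SRG(v,k(k-1),\lambda,\mu)$. Then the line graph of $\mathcal{S}$ is also a strongly regular graph with parameters $SRG(v,k(k-1),\lambda,\mu)$.
   Context: A symmetric $(v_k)$ configuration is a finite incidence structure of $v$ points and $v$ lines such that every line is incident with exactly $k$ points, every point is incident with exactly $k$ lines, and two distinct points are incident with at most one common line (equivalently two distinct lines share at most one point); throughout $k\ge 3$. The point graph has the points as vertices, two distinct points adjacent iff they lie on a common line. The line graph (not in the graph-theoretic sense $L(G)$) has the lines as vertices, two distinct lines adjacent iff they share a point. A graph is $SRG(n,d,\lambda,\mu)$ if it has $n$ vertices, is $d$-regular, any two adjacent vertices have exactly $\lambda$ common neighbours and any two distinct non-adjacent vertices have exactly $\mu$ common neighbours. *)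

theory Defs
  imports "Graph_Theory.Pair_Digraph"
begin

text \<open>
  The incidence relation \<open>I\<close> is a predicate on the whole types; only its restriction to
  \<open>P\<close> and \<open>L\<close> matters. Lines are abstract objects rather than sets of points.
\<close>

locale symmetric_configuration =
  fixes P :: "'p set" and L :: "'l set" and I :: "'p \<Rightarrow> 'l \<Rightarrow> bool" and v k :: nat
  assumes k_ge_3: "k \<ge> 3"
    and finite_points: "finite P" and card_points: "card P = v"
    and finite_lines: "finite L" and card_lines: "card L = v"
    and points_on_line: "l \<in> L \<Longrightarrow> card {p \<in> P. I p l} = k"
    and lines_through_point: "p \<in> P \<Longrightarrow> card {l \<in> L. I p l} = k"
    and joining_line_unique:
      "\<lbrakk>p \<in> P; q \<in> P; p \<noteq> q; l \<in> L; m \<in> L; I p l; I q l; I p m; I q m\<rbrakk> \<Longrightarrow> l = m"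

definition point_graph ::
  "'p set \<Rightarrow> 'l set \<Rightarrow> ('p \<Rightarrow> 'l \<Rightarrow> bool) \<Rightarrow> 'p pair_pre_digraph" where
  "point_graph P L I =
    \<lparr> pverts = P,
      parcs = {(p, q). p \<in> P \<and> q \<in> P \<and> p \<noteq> q \<and> (\<exists>l\<in>L. I p l \<and> I q l)} \<rparr>"

text \<open>
  The graph of intersecting lines of an incidence structure, not the graph-theoretic line graph
  of a graph.
\<close>

definition line_graph ::
  "'p set \<Rightarrow> 'l set \<Rightarrow> ('p \<Rightarrow> 'l \<Rightarrow> bool) \<Rightarrow> 'l pair_pre_digraph" where
  "line_graph P L I =
    \<lparr> pverts = L,
      parcs = {(l, m). l \<in> L \<and> m \<in> L \<and> l \<noteq> m \<and> (\<exists>p\<in>P. I p l \<and> I p m)} \<rparr>"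

text \<open>
  A finite simple graph is a \<^const>\<open>pair_graph\<close>, that is, a finite symmetric loopless digraph.
  No connectedness or non-completeness is required: if there are no pairs of the relevant kind,
  the condition on \<open>\<lambda>\<close> (here \<open>a\<close>) or on \<open>\<mu>\<close> (here \<open>c\<close>) is vacuous.
\<close>

definition common_neighbours :: "'a pair_pre_digraph \<Rightarrow> 'a \<Rightarrow> 'a \<Rightarrow> 'a set" where
  "common_neighbours G x y = {z \<in> pverts G. (x, z) \<in> parcs G \<and> (y, z) \<in> parcs G}"

definition strongly_regular_graph ::
  "'a pair_pre_digraph \<Rightarrow> nat \<Rightarrow> nat \<Rightarrow> nat \<Rightarrow> nat \<Rightarrow> bool" where
  "strongly_regular_graph G n d a c \<longleftrightarrow>
    pair_graph G \<and>
    card (pverts G) = n \<and>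
    (\<forall>x\<in>pverts G. out_degree (with_proj G) x = d) \<and>
    (\<forall>x\<in>pverts G. \<forall>y\<in>pverts G.
      (x, y) \<in> parcs G \<longrightarrow> card (common_neighbours G x y) = a) \<and>
    (\<forall>x\<in>pverts G. \<forall>y\<in>pverts G.
      x \<noteq> y \<and> (x, y) \<notin> parcs G \<longrightarrow> card (common_neighbours G x y) = c)"

definition strongly_regular_configuration ::
  "'p set \<Rightarrow> 'l set \<Rightarrow> ('p \<Rightarrow> 'l \<Rightarrow> bool) \<Rightarrow> nat \<Rightarrow> nat \<Rightarrow> nat \<Rightarrow> nat \<Rightarrow> bool" where
  "strongly_regular_configuration P L I v k a c \<longleftrightarrow>
    symmetric_configuration P L I v k \<and>
    strongly_regular_graph (point_graph P L I) v (k * (k - 1)) a c"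

end

theory Submission
  imports Defs
begin

text \<open>
  Let \<open>N\<close> be the incidence matrix and \<open>M = N N\<^sup>T\<close>, \<open>B = N\<^sup>T N\<close>, so that \<open>M - k\<close> and \<open>B - k\<close> are the
  adjacency matrices of the point graph and the line graph. Strong regularity of the point graph
  says \<open>q(M) = \<mu> J\<close> for a quadratic polynomial \<open>q\<close>. Put \<open>E = q(B) - \<mu> J\<close>. Since \<open>N B = M N\<close> and
  all row and column sums of \<open>N\<close> are \<open>k\<close>, we get \<open>N E = q(M) N - \<mu> N J = 0\<close>, hence \<open>B E = 0\<close> and
  \<open>J E = 0\<close>, so \<open>E\<^sup>2 = q(0) E\<close>. Because the line graph is \<open>k (k - 1)\<close>-regular, the diagonal of \<open>E\<close>
  vanishes. Thus the symmetric matrix \<open>E\<close> has \<open>E\<^sup>2\<close> with zero diagonal, and \<open>E = 0\<close>. The argument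
  needs neither invertibility of \<open>N\<close> nor connectedness.
\<close>

text \<open>Associativity of row vector times matrix times column vector; rewriting with it in
  either direction re-brackets the matrix products below.\<close>

lemma sum_mult_assoc:
  fixes f :: "'a \<Rightarrow> 'c :: comm_semiring_0"
  shows "(\<Sum>y\<in>Y. (\<Sum>x\<in>X. f x * g x y) * h y) = (\<Sum>x\<in>X. f x * (\<Sum>y\<in>Y. g x y * h y))"
  unfolding sum_distrib_right sum_distrib_left
  by (subst sum.swap) (simp add: mult.assoc)

text \<open>Here q(x) = x^2 + b x + c, and \<open>u\<close> becomes \<mu> in the application. The
  entries lie in an ordered domain so that a vanishing sum of squares forces each square to
  vanish.\<close>

lemma gram_polynomial_transfer:
  fixes N :: "'p \<Rightarrow> 'l \<Rightarrow> 'c :: linordered_idom"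
  assumes fin: "finite P" "finite L"
    and k: "k \<noteq> 0"
    and row: "\<And>p. p \<in> P \<Longrightarrow> (\<Sum>l\<in>L. N p l) = k"
    and col: "\<And>l. l \<in> L \<Longrightarrow> (\<Sum>p\<in>P. N p l) = k"
  defines "M \<equiv> \<lambda>p q. \<Sum>l\<in>L. N p l * N q l"
    and "B \<equiv> \<lambda>l m. \<Sum>p\<in>P. N p l * N p m"
  assumes M: "\<And>p q. p \<in> P \<Longrightarrow> q \<in> P \<Longrightarrow>
      (\<Sum>r\<in>P. M p r * M r q) + b * M p q + c * of_bool (p = q) = u"
    and diag: "\<And>l. l \<in> L \<Longrightarrow> (\<Sum>m\<in>L. B l m * B m l) + b * B l l + c = u"
    and l: "l \<in> L" and m: "m \<in> L"
  shows "(\<Sum>s\<in>L. B l s * B s m) + b * B l m + c * of_bool (l = m) = u"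
proof -
  define E where "E l m = (\<Sum>s\<in>L. B l s * B s m) + b * B l m + c * of_bool (l = m) - u" for l m
  have NB: "(\<Sum>m\<in>L. N p m * B m l) = (\<Sum>q\<in>P. M p q * N q l)" for p l
    unfolding M_def B_def sum_mult_assoc by (simp add: mult_ac)
  \<comment> \<open>Re-bracket and apply \<open>NB\<close> twice: N (B B) = (M N) B = M (N B) = (M
    M) N.\<close>
  have NBB: "(\<Sum>m\<in>L. N p m * (\<Sum>s\<in>L. B m s * B s l))
      = (\<Sum>r\<in>P. (\<Sum>q\<in>P. M p q * M q r) * N r l)" for p l
    unfolding sum_mult_assoc [symmetric] NB
    unfolding sum_mult_assoc NB ..
  have NE: "(\<Sum>m\<in>L. N p m * E m l) = 0" if "p \<in> P" "l \<in> L" for p l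
  proof -
    have d1: "(\<Sum>m\<in>L. N p m * (c * of_bool (m = l))) = c * N p l"
      using that fin by (simp add: of_bool_def if_distrib cong: if_cong)
    have d2: "(\<Sum>r\<in>P. (c * of_bool (p = r)) * N r l) = c * N p l"
      using that fin by (simp add: of_bool_def if_distrib if_distribR cong: if_cong)
    have "(\<Sum>m\<in>L. N p m * E m l)
        = (\<Sum>m\<in>L. N p m * (\<Sum>s\<in>L. B m s * B s l)) + b * (\<Sum>m\<in>L. N p m * B m l) 
          + c * N p l - (\<Sum>m\<in>L. N p m) * u"
      unfolding d1 [symmetric] E_def
      by (simp add: algebra_simps sum.distrib sum_subtractf sum_distrib_left)
    also have "\<dots> = (\<Sum>r\<in>P. ((\<Sum>q\<in>P. M p q * M q r) + b * M p r + c * of_bool (p = r)) * N r l)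
         - k * u"
      unfolding NBB NB row [OF that(1)] d2 [symmetric]
      by (simp add: algebra_simps sum.distrib sum_distrib_left)
    also have "\<dots> = (\<Sum>r\<in>P. u * N r l) - k * u"
      using M that by simp
    \<comment> \<open>The column sum of \<open>N\<close> equals the row sum \<open>k\<close>, so the
      two terms cancel.\<close>
    also have "\<dots> = 0"
      using col that by (simp flip: sum_distrib_left)
    finally show ?thesis .
  qed
  have BE: "(\<Sum>m\<in>L. B s m * E m l) = 0" if "l \<in> L" for s l
    using NE that unfolding B_def sum_mult_assoc by simp
  have JE: "(\<Sum>m\<in>L. E m l) = 0" if "l \<in> L" for l
  proof -
    \<comment> \<open>Since all column sums are \<open>k\<close>, the sum of the rows of
      \<open>N\<close> is \<open>k\<close> times the all-ones row, and every row of \<open>N\<close>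
      annihilates \<open>E\<close>.\<close>
    have "k * (\<Sum>m\<in>L. E m l) = (\<Sum>m\<in>L. (\<Sum>p\<in>P. 1 * N p m) * E m l)"
      using col by (simp add: sum_distrib_left)
    also have "\<dots> = 0"
      using NE that unfolding sum_mult_assoc by simp
    finally show ?thesis using k by simp
  qed
  \<comment> \<open>Only the left factor of the diagonal entry of E^2 is expanded; by
    \<open>BE\<close> and \<open>JE\<close> just the term c E survives.\<close>
  have "(\<Sum>m\<in>L. E l m * E m l) = (\<Sum>m\<in>L. (\<Sum>s\<in>L. B l s * B s m) * E m l)
     + b * (\<Sum>m\<in>L. B l m * E m l) + (\<Sum>m\<in>L. c * of_bool (l = m) * E m l) - u * (\<Sum>m\<in>L. E m l)"
    unfolding E_def [of l] by (simp add: algebra_simps sum.distrib sum_subtractf sum_distrib_left)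
  also have "\<dots> = (\<Sum>m\<in>L. c * of_bool (l = m) * E m l)"
    using l unfolding sum_mult_assoc by (simp add: BE JE)
  also have "\<dots> = 0"
    using diag l by (intro sum.neutral) (auto simp: E_def of_bool_def)
  \<comment> \<open>\<open>E\<close> is symmetric, so this diagonal entry is a sum of
    squares.\<close>
  also have "(\<Sum>m\<in>L. E l m * E m l) = (\<Sum>m\<in>L. E l m * E l m)"
    unfolding E_def B_def by (simp add: mult_ac eq_commute)
  finally have "E l m * E l m = 0"
    using m fin by (subst (asm) sum_nonneg_eq_0_iff) auto
  then show ?thesis by (simp add: E_def)
qed

text \<open>The common neighbours of a vertex with itself are its neighbours, so regularity becomes
  the diagonal case of one condition on the squared adjacency matrix.\<close>

lemma strongly_regular_graph_iff:
  "strongly_regular_graph G n d a c \<longleftrightarrow> pair_graph G \<and> card (pverts G) = n \<and>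
    (\<forall>x\<in>pverts G. \<forall>y\<in>pverts G. card (common_neighbours G x y) =
      (if x = y then d else if (x, y) \<in> parcs G then a else c))"
proof (cases "pair_graph G")
  case True
  then interpret pair_graph G .
  have "bij_betw snd (out_arcs (with_proj G) x) (common_neighbours G x x)" for x
    by (rule bij_betw_byWitness [where f' = "Pair x"])
      (auto simp: common_neighbours_def dest: in_arcsD2)
  then have degree: "out_degree (with_proj G) x = card (common_neighbours G x x)" for x
    unfolding out_degree_def by (rule bij_betw_same_card)
  have "(x, x) \<notin> parcs G" for x
    using no_loops by fastforce
  with True show ?thesis
    unfolding strongly_regular_graph_def degree by (intro iffI conjI ballI) simp_all
qed (simp add: strongly_regular_graph_def)

context symmetric_configuration
begin

text \<open>Two distinct points on two distinct lines are excluded, a self-dual condition. Facts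
  about point graphs thus carry over to line graphs.\<close>

lemma dual: "symmetric_configuration L P (\<lambda>l p. I p l) v k"
  by unfold_locales
    (use k_ge_3 finite_points card_points finite_lines card_lines points_on_line
      lines_through_point joining_line_unique in blast)+

lemma pair_graph_point_graph: "pair_graph (point_graph P L I)"
  by unfold_locales
    (use finite_points in \<open>auto simp: point_graph_def symmetric_def intro!: symI
      intro: finite_subset [of _ "P \<times> P"]\<close>)

lemma line_incidence_sum: "p \<in> P \<Longrightarrow> (\<Sum>l\<in>L. of_bool (I p l)) = (of_nat k :: 'a :: semiring_1)"
  using finite_lines lines_through_point by (simp add: Int_def)

text \<open>Two distinct points share at most one line, so M = A + k I with \<open>A\<close> the
  adjacency matrix.\<close>

lemma gram_entry:
  assumes "p \<in> P" "q \<in> P"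
  shows "(\<Sum>l\<in>L. of_bool (I p l) * of_bool (I q l)) =
    (of_bool ((p, q) \<in> parcs (point_graph P L I)) + of_nat k * of_bool (p = q) :: int)"
proof -
  have *: "(\<Sum>l\<in>L. of_bool (I p l) * of_bool (I q l)) = int (card {l\<in>L. I p l \<and> I q l})"
    using finite_lines by (simp add: Int_def flip: of_bool_conj)
  show ?thesis
  proof (cases "p = q")
    case True
    then show ?thesis
      using assms lines_through_point unfolding * by (simp add: point_graph_def)
  next
    case False
    show ?thesis
    proof (cases "\<exists>l\<in>L. I p l \<and> I q l")
      case True
      then obtain l where "l \<in> L" "I p l" "I q l" by blast
      then have "{l\<in>L. I p l \<and> I q l} = {l}"
        using joining_line_unique [of p q] assms False by blast
      then show ?thesis
        using assms True False unfolding * by (simp add: point_graph_def)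
    next
      case none: False
      then have "{l\<in>L. I p l \<and> I q l} = {}" by blast
      then show ?thesis
        using none False by (simp add: * point_graph_def del: Collect_empty_eq)
    qed
  qed
qed

text \<open>Expand (A + k I)^2 = A^2 + 2 k A + k^2 I; as \<open>A\<close> is symmetric, entries of
  A^2 count common neighbours.\<close>

lemma gram_square_entry:
  assumes "p \<in> P" "q \<in> P"
  shows "(\<Sum>r\<in>P. (\<Sum>l\<in>L. of_bool (I p l) * of_bool (I r l)) * (\<Sum>l\<in>L. of_bool (I r l) * of_bool (I q l))) =
    (int (card (common_neighbours (point_graph P L I) p q))
      + 2 * int k * of_bool ((p, q) \<in> parcs (point_graph P L I)) + int k ^ 2 * of_bool (p = q))"
proof -
  let ?A = "parcs (point_graph P L I)"
  have sym: "(r, q) \<in> ?A \<longleftrightarrow> (q, r) \<in> ?A" and loopfree: "(r, r) \<notin> ?A" for r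
    by (auto simp: point_graph_def)
  have "(\<Sum>r\<in>P. (\<Sum>l\<in>L. of_bool (I p l) * of_bool (I r l)) * (\<Sum>l\<in>L. of_bool (I r l) * of_bool (I q l)))
     = (\<Sum>r\<in>P. (of_bool ((p, r) \<in> ?A) + int k * of_bool (p = r)) *
         (of_bool ((q, r) \<in> ?A) + int k * of_bool (r = q)))"
    using assms by (intro sum.cong refl) (simp only: gram_entry sym [symmetric])
  also have "\<dots> = (\<Sum>r\<in>P. of_bool ((p, r) \<in> ?A \<and> (q, r) \<in> ?A))
      + (\<Sum>r\<in>P. if r = q then int k * of_bool ((p, r) \<in> ?A) else 0)
      + (\<Sum>r\<in>P. if r = p then int k * of_bool ((q, r) \<in> ?A) else 0)
      + (\<Sum>r\<in>P. if r = p then int k ^ 2 * of_bool (r = q) else 0)"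
    unfolding sum.distrib [symmetric]
  proof (intro sum.cong refl)
    fix r
    show "(of_bool ((p, r) \<in> ?A) + int k * of_bool (p = r)) *
        (of_bool ((q, r) \<in> ?A) + int k * of_bool (r = q)) =
      of_bool ((p, r) \<in> ?A \<and> (q, r) \<in> ?A)
      + (if r = q then int k * of_bool ((p, r) \<in> ?A) else 0)
      + (if r = p then int k * of_bool ((q, r) \<in> ?A) else 0)
      + (if r = p then int k ^ 2 * of_bool (r = q) else 0)"
      by (cases "r = p"; cases "r = q") (simp_all add: loopfree power2_eq_square of_bool_conj)
  qed
  also have "\<dots> = int (card {r\<in>P. (p, r) \<in> ?A \<and> (q, r) \<in> ?A}) + 2 * int k * of_bool ((p, q) \<in> ?A)
       + int k ^ 2 * of_bool (p = q)"
    using assms finite_points by (simp add: Int_def sym [of p])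
  finally show ?thesis
    by (simp add: common_neighbours_def point_graph_def)
qed

text \<open>Each row of A + k I = M sums to k^2, since both \<open>N\<close> and its transpose have
  row sums \<open>k\<close>.\<close>

lemma degree_point_graph:
  assumes "p \<in> P"
  shows "card (common_neighbours (point_graph P L I) p p) = k * (k - 1)"
proof -
  interpret dual: symmetric_configuration L P "\<lambda>l p. I p l" v k
    by (rule dual)
  let ?A = "parcs (point_graph P L I)"
  have "(\<Sum>q\<in>P. of_bool ((p, q) \<in> ?A) + int k * of_bool (p = q))
      = (\<Sum>q\<in>P. (\<Sum>l\<in>L. of_bool (I p l) * of_bool (I q l)) * 1)"
    using assms by (intro sum.cong) (simp_all add: gram_entry)
  also have "\<dots> = (\<Sum>l\<in>L. of_bool (I p l) * int k)"
    unfolding sum_mult_assoc by (intro sum.cong) (simp_all add: dual.line_incidence_sum)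
  also have "\<dots> = int k * int k"
    using assms by (simp add: line_incidence_sum flip: sum_distrib_right)
  also have "(\<Sum>q\<in>P. of_bool ((p, q) \<in> ?A) + int k * of_bool (p = q))
      = (\<Sum>q\<in>P. of_bool ((p, q) \<in> ?A)) + (\<Sum>q\<in>P. if p = q then int k else 0)"
    unfolding sum.distrib [symmetric] by (intro sum.cong) auto
  finally have "int (card {q\<in>P. (p, q) \<in> ?A}) + int k = int k * int k"
    using assms finite_points by (simp add: Int_def)
  then have "int (card {q\<in>P. (p, q) \<in> ?A}) = int (k * (k - 1))"
    using k_ge_3 by (simp add: of_nat_diff algebra_simps)
  then have "card {q\<in>P. (p, q) \<in> ?A} = k * (k - 1)"
    by (simp only: of_nat_eq_iff)
  then show ?thesis
    by (simp add: common_neighbours_def point_graph_def)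
qed

text \<open>
  The coefficients are those of \<open>q(x) = (x - k)\<^sup>2 - (\<lambda> - \<mu>) (x - k) - (k (k - 1) - \<mu>)\<close>.
\<close>

lemma gram_polynomial_iff:
  fixes a c :: nat
  assumes "p \<in> P" "q \<in> P"
  defines "M \<equiv> \<lambda>p q. \<Sum>l\<in>L. of_bool (I p l) * of_bool (I q l)"
  shows "(\<Sum>r\<in>P. M p r * M r q) + (int c - int a - 2 * int k) * M p q
      + (int k + int k * (int a - int c) + int c) * of_bool (p = q) = int c \<longleftrightarrow>
    card (common_neighbours (point_graph P L I) p q) =
      (if p = q then k * (k - 1) else if (p, q) \<in> parcs (point_graph P L I) then a else c)"
proof -
  have "(p, p) \<notin> parcs (point_graph P L I)"
    by (simp add: point_graph_def)
  moreover have "int (k * (k - 1)) = int k ^ 2 - int k"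
    using k_ge_3 by (simp add: of_nat_diff power2_eq_square algebra_simps)
  \<comment> \<open>Substituting M = A + k I leaves A^2 + (c - a) A + (c - k (k - 1)) I = c J, read
    off for equal, adjacent and non-adjacent points.\<close>
  ultimately show ?thesis
    unfolding M_def gram_square_entry [OF assms(1,2)] gram_entry [OF assms(1,2)]
    by (auto simp: degree_point_graph assms algebra_simps power2_eq_square simp del: of_nat_mult)
qed

end

lemma line_graph_eq_point_graph: "line_graph P L I = point_graph L P (\<lambda>l p. I p l)"
  by (simp add: line_graph_def point_graph_def)

theorem theorem4:
  fixes P :: "'p set" and L :: "'l set" and I :: "'p \<Rightarrow> 'l \<Rightarrow> bool"
    and v k lam mu :: nat
  assumes "strongly_regular_configuration P L I v k lam mu"
  shows "strongly_regular_graph (line_graph P L I) v (k * (k - 1)) lam mu"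
proof -
  interpret symmetric_configuration P L I v k
    using assms by (simp add: strongly_regular_configuration_def)
  interpret dual: symmetric_configuration L P "\<lambda>l p. I p l" v k
    by (rule dual)
  have pverts [simp]: "pverts (point_graph P L I) = P" "pverts (point_graph L P (\<lambda>l p. I p l)) = L"
    by (simp_all add: point_graph_def)
  have points: "\<forall>p\<in>P. \<forall>q\<in>P. card (common_neighbours (point_graph P L I) p q) =
      (if p = q then k * (k - 1) else if (p, q) \<in> parcs (point_graph P L I) then lam else mu)"
    using assms by (simp add: strongly_regular_configuration_def strongly_regular_graph_iff)
  have "card (common_neighbours (point_graph L P (\<lambda>l p. I p l)) l m) =
      (if l = m then k * (k - 1)
       else if (l, m) \<in> parcs (point_graph L P (\<lambda>l p. I p l)) then lam else mu)"
    if "l \<in> L" "m \<in> L" for l m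
    \<comment> \<open>The claim becomes the polynomial identity for \<open>B\<close>. Its diagonal
      comes from the degree in the dual configuration, the identity for \<open>M\<close> from
      \<open>points\<close>.\<close>
    unfolding dual.gram_polynomial_iff [OF that, symmetric]
  proof (rule gram_polynomial_transfer [where k = "int k"])
    fix l assume l: "l \<in> L"
    then show "(\<Sum>m\<in>L. (\<Sum>p\<in>P. of_bool (I p l) * of_bool (I p m)) * (\<Sum>p\<in>P. of_bool (I p m) * of_bool (I p l)))
        + (int mu - int lam - 2 * int k) * (\<Sum>p\<in>P. of_bool (I p l) * of_bool (I p l))
        + (int k + int k * (int lam - int mu) + int mu) = int mu"
      using dual.gram_polynomial_iff [OF l l, of mu lam] by (simp add: dual.degree_point_graph)
  next
    fix p q assume "p \<in> P" "q \<in> P"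
    then show "(\<Sum>r\<in>P. (\<Sum>l\<in>L. of_bool (I p l) * of_bool (I r l)) * (\<Sum>l\<in>L. of_bool (I r l) * of_bool (I q l)))
        + (int mu - int lam - 2 * int k) * (\<Sum>l\<in>L. of_bool (I p l) * of_bool (I q l))
        + (int k + int k * (int lam - int mu) + int mu) * of_bool (p = q) = int mu"
      using points by (subst gram_polynomial_iff) auto
  qed (use that k_ge_3 finite_points finite_lines in
      \<open>simp_all add: line_incidence_sum dual.line_incidence_sum del: sum_of_bool_eq\<close>)
  then show ?thesis
    by (simp add: line_graph_eq_point_graph strongly_regular_graph_iff dual.pair_graph_point_graph
        card_lines)
qed

end
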